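(* Let $Z_0\in B_b(S\times A)$ and $T>0$. Suppose $Z\in C^1([0,T);B_b(S\times A))$ satisfies $Z|_{t=0}=Z_0$ and, for $t\in(0,T)$ and all $(s,a)\in S\times A$, $$\partial_tZ_t(s,a)=-\big(Q^{\pi_t}_\tau(s,a)+\tau Z_t(s,a)-V^{\pi_t}_\tau(s)\big),$$ where $\pi_t=\boldsymbol\pi(Z_t)$ for all $t\in[0,T)$. Then $t\mapsto V^{\pi_t}_\tau$ is differentiable, and $\partial_tV^{\pi_t}_\tau(s)\le0$ for all $s\in S$ and $t\in[0,T)$.
   Context: $S,A$ are Polish spaces (with Borel $\sigma$-algebras), $P$ is a probability kernel from $S\times A$ to $S$ (written $P(ds'|s,a)$), $c:S\times A\to\mathbb R$ is bounded measurable, $\gamma\in[0,1)$, $\mu$ is a probability measure on $A$, $\tau\in(0,\infty)$. $B_b(E)$ denotes bounded measurable real functions on $E$ with the sup norm. $\mathrm{KL}(m|m')=\int\ln\frac{\mathrm dm}{\mathrm dm'}\,dm$ if $m\ll m'$, and $+\infty$ otherwise. For $f\in B_b(S\times A)$ put $\boldsymbol\pi(f)(da|s)=\frac{e^{f(s,a)}}{\int_A e^{f(s,a')}\mu(da')}\mu(da)$, and $\Pi_\mu=\{\boldsymbol\pi(f): f\in B_b(S\times A)\}$. For $\pi\in\Pi_\mu$, let $\mathbb E^\pi_s$ be expectation for the controlled process with $s_0=s$, $a_n\sim\pi(\cdot|s_n)$, $s_{n+1}\sim P(\cdot|s_n,a_n)$. Define $V^\pi_\tau\in B_b(S)$ by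 $V^\pi_\tau(s)=\mathbb E^\pi_s\big[\sum_{n\ge0}\gamma^n\big(c(s_n,a_n)+\tau\,\mathrm{KL}(\pi(\cdot|s_n)|\mu)\big)\big]$ and $Q^\pi_\tau(s,a)=c(s,a)+\gamma\int_S V^\pi_\tau(s')P(ds'|s,a)$. *)

theory Defs
  imports "HOL-Probability.Probability"
begin

section \<open>Bounded Borel functions with the sup norm\<close>

typedef (overloaded) 'a bmfun =
  "{f :: 'a::topological_space \<Rightarrow> real. f \<in> borel_measurable borel \<and> bounded (range f)}"
  morphisms apply_bmfun Bmfun
  by (intro exI[of _ "\<lambda>_. 0"]) auto

declare [[coercion "apply_bmfun :: 'a::topological_space bmfun \<Rightarrow> 'a \<Rightarrow> real"]]

setup_lifting type_definition_bmfun

lemma apply_bmfun_measurable [measurable, simp]: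
  "apply_bmfun f \<in> borel_measurable borel"
  and bounded_apply_bmfun [simp]: "bounded (range (apply_bmfun f))"
  using apply_bmfun[of f] by auto

lemma bmfun_eqI: "(\<And>x. apply_bmfun f x = apply_bmfun g x) \<Longrightarrow> f = g"
  by transfer auto

lemma bdd_above_abs_bmfun: "bdd_above (range (\<lambda>x. \<bar>apply_bmfun f x\<bar>))"
proof -
  obtain B where "\<And>x. \<bar>apply_bmfun f x\<bar> \<le> B"
    using bounded_apply_bmfun[of f] unfolding bounded_iff by auto
  then show ?thesis by (intro bdd_aboveI2) auto
qed

instantiation bmfun :: (topological_space) real_vector
begin

lift_definition zero_bmfun :: "'a bmfun" is "\<lambda>_. 0" by auto

lift_definition plus_bmfun :: "'a bmfun \<Rightarrow> 'a bmfun \<Rightarrow> 'a bmfun" is "\<lambda>f g x. f x + g x"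
  by (auto intro: bounded_plus_comp)

lift_definition uminus_bmfun :: "'a bmfun \<Rightarrow> 'a bmfun" is "\<lambda>f x. - f x"
  by auto

lift_definition minus_bmfun :: "'a bmfun \<Rightarrow> 'a bmfun \<Rightarrow> 'a bmfun" is "\<lambda>f g x. f x - g x"
  by (auto intro: bounded_minus_comp)

lift_definition scaleR_bmfun :: "real \<Rightarrow> 'a bmfun \<Rightarrow> 'a bmfun" is "\<lambda>r f x. r * f x"
  by (auto intro: bounded_scaleR_comp[where 'b = real, simplified])

lemmas bmfun_rep_eqs [simp] =
  zero_bmfun.rep_eq plus_bmfun.rep_eq uminus_bmfun.rep_eq minus_bmfun.rep_eq scaleR_bmfun.rep_eq

instance
  by standard (auto intro!: bmfun_eqI simp: algebra_simps)

end

instantiation bmfun :: (topological_space) real_normed_vector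
begin

definition norm_bmfun :: "'a bmfun \<Rightarrow> real"
  where "norm_bmfun f = (SUP x. \<bar>apply_bmfun f x\<bar>)"

definition dist_bmfun :: "'a bmfun \<Rightarrow> 'a bmfun \<Rightarrow> real"
  where "dist_bmfun f g = norm (f - g)"

definition sgn_bmfun :: "'a bmfun \<Rightarrow> 'a bmfun"
  where "sgn_bmfun f = f /\<^sub>R norm f"

definition uniformity_bmfun :: "('a bmfun \<times> 'a bmfun) filter"
  where "uniformity_bmfun = (INF e\<in>{0 <..}. principal {(x, y). dist x y < e})"

definition open_bmfun :: "'a bmfun set \<Rightarrow> bool"
  where "open_bmfun S = (\<forall>x\<in>S. \<forall>\<^sub>F (x', y) in uniformity. x' = x \<longrightarrow> y \<in> S)"

lemma abs_le_norm_bmfun: "\<bar>apply_bmfun f x\<bar> \<le> norm f"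
  unfolding norm_bmfun_def by (intro cSUP_upper bdd_above_abs_bmfun) simp

lemma norm_bmfun_le: "(\<And>x. \<bar>apply_bmfun f x\<bar> \<le> b) \<Longrightarrow> norm f \<le> b"
  unfolding norm_bmfun_def by (intro cSUP_least) auto

instance
proof
  fix a :: real and f g :: "'a bmfun"
  show "dist f g = norm (f - g)" by (rule dist_bmfun_def)
  show "sgn f = f /\<^sub>R norm f" by (rule sgn_bmfun_def)
  show "norm f = 0 \<longleftrightarrow> f = 0"
  proof
    assume "norm f = 0"
    then have "apply_bmfun f x = 0" for x using abs_le_norm_bmfun[of f x] by simp
    then show "f = 0" by (intro bmfun_eqI) simp
  qed (simp add: norm_bmfun_def)
  show "norm (f + g) \<le> norm f + norm g"
  proof (rule norm_bmfun_le)
    fix x show "\<bar>apply_bmfun (f + g) x\<bar> \<le> norm f + norm g"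
      using abs_le_norm_bmfun[of f x] abs_le_norm_bmfun[of g x] by simp
  qed
  have le: "norm (b *\<^sub>R h) \<le> \<bar>b\<bar> * norm h" for b :: real and h :: "'a bmfun"
    by (intro norm_bmfun_le) (simp add: abs_mult abs_le_norm_bmfun mult_left_mono)
  show "norm (a *\<^sub>R f) = \<bar>a\<bar> * norm f"
  proof (cases "a = 0")
    case True
    with True show ?thesis by (simp add: norm_bmfun_def)
  next
    case False
    have "inverse a *\<^sub>R (a *\<^sub>R f) = f" using False by (intro bmfun_eqI) simp
    with le[of "inverse a" "a *\<^sub>R f"] have "norm f \<le> \<bar>inverse a\<bar> * norm (a *\<^sub>R f)" by simp
    with False have "\<bar>a\<bar> * norm f \<le> norm (a *\<^sub>R f)" by (simp add: field_simps)
    with le[of a f] show ?thesis by simp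
  qed
qed (rule open_bmfun_def uniformity_bmfun_def)+

end

section \<open>Entropy-regularised Markov decision processes\<close>

text \<open>Relative entropy of \<open>m\<close> with respect to \<open>m'\<close>. For probability measures
  \<open>m \<lless> m'\<close> the negative part of \<open>ln (dm/dm')\<close> is always \<open>m\<close>-integrable, so failure of
  integrability means that the integral is \<open>\<infinity>\<close>, whereas the Bochner integral in
  \<^const>\<open>KL_divergence\<close> would be \<open>0\<close>.\<close>

definition KL :: "'a measure \<Rightarrow> 'a measure \<Rightarrow> ereal" where
  "KL m m' =
    (if absolutely_continuous m' m \<and> integrable m (entropy_density (exp 1) m' m)
     then ereal (KL_divergence (exp 1) m' m) else \<infinity>)"

definition softmax_policy ::
  "'a::polish_space measure \<Rightarrow> ('s::polish_space \<times> 'a) bmfun \<Rightarrow> 's \<Rightarrow> 'a measure" where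
  "softmax_policy \<mu> f s =
    density \<mu> (\<lambda>a. ennreal (exp (f (s, a)) / (\<integral>a'. exp (f (s, a')) \<partial>\<mu>)))"

lemma softmax_policy_kernel:
  fixes f :: "('s::polish_space \<times> 'a::polish_space) bmfun"
  assumes "prob_space \<mu>" and sets [measurable_cong]: "sets \<mu> = sets borel"
  shows "softmax_policy \<mu> f \<in> borel \<rightarrow>\<^sub>M prob_algebra borel"
    and "KL (softmax_policy \<mu> f s) \<mu> < \<infinity>"
proof -
  interpret prob_space \<mu> by fact
  have space: "space \<mu> = UNIV" using sets_eq_imp_space_eq[OF sets] by simp
  have f [measurable]: "apply_bmfun f \<in> borel_measurable (borel \<Otimes>\<^sub>M borel)"
    by (simp add: borel_prod)
  define B where "B = norm f"
  have B: "\<bar>f x\<bar> \<le> B" for x unfolding B_def by (rule abs_le_norm_bmfun)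
  have B': "f x \<le> B" "- B \<le> f x" for x using B[of x] by auto
  define N where "N s = (\<integral>a. exp (f (s, a)) \<partial>\<mu>)" for s
  have int: "integrable \<mu> (\<lambda>a. exp (f (s, a)))" for s
    by (rule integrable_const_bound[of _ "exp B"]) (auto simp: B')
  have N_ge: "exp (- B) \<le> N s" for s
  proof -
    have "(\<integral>a. exp (- B) \<partial>\<mu>) \<le> N s"
      unfolding N_def by (intro integral_mono int) (auto simp: B')
    then show ?thesis by (simp add: prob_space)
  qed
  have N_le: "N s \<le> exp B" for s
  proof -
    have "N s \<le> (\<integral>a. exp B \<partial>\<mu>)"
      unfolding N_def by (intro integral_mono int) (auto simp: B')
    then show ?thesis by (simp add: prob_space)
  qed
  have N_pos: "0 < N s" for s using N_ge[of s] by (rule less_le_trans[rotated]) simp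
  define g where "g s a = exp (f (s, a)) / N s" for s a
  have sp: "softmax_policy \<mu> f s = density \<mu> (\<lambda>a. ennreal (g s a))" for s
    by (simp add: softmax_policy_def g_def N_def)
  have [measurable]: "N \<in> borel_measurable borel"
    unfolding N_def by measurable
  have g [measurable]: "(\<lambda>(s, a). g s a) \<in> borel_measurable (borel \<Otimes>\<^sub>M borel)"
    unfolding g_def by measurable
  have g_pos: "0 < g s a" for s a using N_pos by (simp add: g_def)
  have g_int: "integrable \<mu> (g s)" "(\<integral>a. g s a \<partial>\<mu>) = 1" for s
    using int[of s] N_pos[of s] by (auto simp: g_def[abs_def] N_def[symmetric])
  have prob: "prob_space (softmax_policy \<mu> f s)" for s
  proof
    have "emeasure (density \<mu> (\<lambda>a. ennreal (g s a))) (space \<mu>) = (\<integral>\<^sup>+a. ennreal (g s a) \<partial>\<mu>)"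
      by (subst emeasure_density) (auto intro!: nn_integral_cong)
    also have "\<dots> = 1"
      using g_int[of s] g_pos by (subst nn_integral_eq_integral) (auto intro: less_imp_le)
    finally show "emeasure (softmax_policy \<mu> f s) (space (softmax_policy \<mu> f s)) = 1"
      by (simp add: sp)
  qed
  show "softmax_policy \<mu> f \<in> borel \<rightarrow>\<^sub>M prob_algebra borel"
  proof (rule measurable_prob_algebraI[OF prob], rule measurable_subprob_algebra)
    show "subprob_space (softmax_policy \<mu> f s)" for s
      using prob by (rule prob_space_imp_subprob_space)
    show "sets (softmax_policy \<mu> f s) = sets borel" for s
      by (simp add: sp sets)
    fix A :: "'a set" assume A [measurable]: "A \<in> sets borel"
    have "(\<lambda>s. \<integral>\<^sup>+a. ennreal (g s a) * indicator A a \<partial>\<mu>) \<in> borel_measurable borel"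
      by measurable
    then show "(\<lambda>s. emeasure (softmax_policy \<mu> f s) A) \<in> borel_measurable borel"
      by (simp add: sp emeasure_density)
  qed
  interpret D: prob_space "softmax_policy \<mu> f s" by (rule prob)
  have ac: "absolutely_continuous \<mu> (softmax_policy \<mu> f s)"
    unfolding sp by (intro absolutely_continuousI_density) simp
  have gb: "\<bar>ln (g s a)\<bar> \<le> 2 * B" for a
  proof -
    have "ln (g s a) = f (s, a) - ln (N s)"
      using N_pos[of s] by (simp add: g_def ln_div)
    moreover have "- B \<le> ln (N s)" "ln (N s) \<le> B"
      using N_ge[of s] N_le[of s] N_pos[of s] by (simp_all add: ln_ge_iff ln_le_cancel_iff[of _ "exp B", simplified])
    ultimately show ?thesis using B'[of "(s, a)"] by (simp add: abs_le_iff)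
  qed
  have "AE a in \<mu>. ennreal (g s a) = RN_deriv \<mu> (density \<mu> (\<lambda>a. ennreal (g s a))) a"
    by (rule RN_deriv_unique) auto
  then have "AE a in \<mu>. norm (entropy_density (exp 1) \<mu> (softmax_policy \<mu> f s) a) \<le> 2 * B"
    unfolding sp
  proof eventually_elim
    case (elim a)
    from this[symmetric] gb[of a] g_pos[of s a] show ?case
      by (simp add: entropy_density_def log_def less_imp_le)
  qed
  then have "AE a in softmax_policy \<mu> f s. norm (entropy_density (exp 1) \<mu> (softmax_policy \<mu> f s) a) \<le> 2 * B"
    by (rule absolutely_continuous_AE[OF _ ac, rotated]) (simp add: sp)
  then have "integrable (softmax_policy \<mu> f s) (entropy_density (exp 1) \<mu> (softmax_policy \<mu> f s))"
    by (rule D.integrable_const_bound) (simp add: sp, measurable)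
  with ac show "KL (softmax_policy \<mu> f s) \<mu> < \<infinity>"
    by (simp add: KL_def)
qed

text \<open>The law of \<open>(s, a)\<close> with \<open>s\<close> fixed and \<open>a\<close> drawn from \<open>\<pi>(\<cdot>|s)\<close>.\<close>

definition draw_action ::
  "('s::polish_space \<Rightarrow> 'a::polish_space measure) \<Rightarrow> 's \<Rightarrow> ('s \<times> 'a) measure" where
  "draw_action \<pi> s = distr (\<pi> s) borel (\<lambda>a. (s, a))"

text \<open>A trajectory is \<open>\<omega> = ((s\<^sub>0, a\<^sub>0), (s\<^sub>1, a\<^sub>1), \<dots>)\<close>; the measure below is the conditional law of
  its \<open>n\<close>-th entry given the earlier ones.\<close>

definition trajectory_kernel ::
  "('s::polish_space \<times> 'a::polish_space \<Rightarrow> 's measure) \<Rightarrow> ('s \<Rightarrow> 'a measure) \<Rightarrow> 's \<Rightarrow>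
   nat \<Rightarrow> (nat \<Rightarrow> 's \<times> 'a) \<Rightarrow> ('s \<times> 'a) measure" where
  "trajectory_kernel P \<pi> s n \<omega> =
    (case n of 0 \<Rightarrow> draw_action \<pi> s | Suc k \<Rightarrow> P (\<omega> k) \<bind> draw_action \<pi>)"

text \<open>The Ionescu-Tulcea measure of \<^const>\<open>trajectory_kernel\<close>: outside the locale
  \<^locale>\<open>Ionescu_Tulcea\<close>, this is what \<open>PF.lim\<close> abbreviates.\<close>

definition trajectory_measure ::
  "('s::polish_space \<times> 'a::polish_space \<Rightarrow> 's measure) \<Rightarrow> ('s \<Rightarrow> 'a measure) \<Rightarrow> 's \<Rightarrow>
   (nat \<Rightarrow> 's \<times> 'a) measure" where
  "trajectory_measure P \<pi> s =
    projective_family.lim UNIV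
      (Ionescu_Tulcea.CI (trajectory_kernel P \<pi> s) (\<lambda>_. borel)) (\<lambda>_. borel)"

lemma Ionescu_Tulcea_trajectory_kernel:
  fixes P :: "'s::polish_space \<times> 'a::polish_space \<Rightarrow> 's measure"
  assumes P [measurable]: "P \<in> borel \<rightarrow>\<^sub>M prob_algebra borel"
    and \<pi> [measurable]: "\<pi> \<in> borel \<rightarrow>\<^sub>M prob_algebra borel"
  shows "Ionescu_Tulcea (trajectory_kernel P \<pi> s) (\<lambda>_. borel)"
proof -
  have draw: "draw_action \<pi> \<in> borel \<rightarrow>\<^sub>M prob_algebra borel"
    unfolding draw_action_def
    by (rule measurable_distr_prob_space2[OF \<pi>]) (simp add: borel_prod case_prod_unfold)
  have kernel: "trajectory_kernel P \<pi> s n \<in> PiM {0..<n} (\<lambda>_. borel) \<rightarrow>\<^sub>M prob_algebra borel" for n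
  proof (cases n)
    case 0
    have "draw_action \<pi> s \<in> space (prob_algebra borel)"
      using measurable_space[OF draw, of s] by simp
    with 0 show ?thesis by (simp add: trajectory_kernel_def[abs_def])
  next
    case (Suc k)
    have "(\<lambda>\<omega>. \<omega> k) \<in> PiM {0..<n} (\<lambda>_. borel :: ('s \<times> 'a) measure) \<rightarrow>\<^sub>M borel"
      using measurable_component_singleton[of k "{0..<n}" "\<lambda>_. borel"] by (simp add: Suc)
    from measurable_bind_prob_space[OF measurable_compose[OF this P] draw] show ?thesis
      by (simp add: trajectory_kernel_def[abs_def] Suc)
  qed
  show ?thesis
    unfolding Ionescu_Tulcea_def
    using measurable_prob_algebraD[OF kernel] measurable_space[OF kernel]
    by (auto simp: space_prob_algebra)
qed

text \<open>By \<open>softmax_policy_kernel\<close>, \<^const>\<open>real_of_ereal\<close> is applied to a finite relative entropy whenever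
  \<open>\<pi> = softmax_policy \<mu> f\<close>.\<close>

definition state_value ::
  "('s::polish_space \<times> 'a::polish_space \<Rightarrow> 's measure) \<Rightarrow> ('s \<times> 'a) bmfun \<Rightarrow> real \<Rightarrow>
   'a measure \<Rightarrow> real \<Rightarrow> ('s \<Rightarrow> 'a measure) \<Rightarrow> 's \<Rightarrow> real" where
  "state_value P c \<gamma> \<mu> \<tau> \<pi> s =
    (\<integral>\<omega>. (\<Sum>n. \<gamma> ^ n * (c (\<omega> n) + \<tau> * real_of_ereal (KL (\<pi> (fst (\<omega> n))) \<mu>)))
      \<partial>trajectory_measure P \<pi> s)"

definition action_value ::
  "('s::polish_space \<times> 'a::polish_space \<Rightarrow> 's measure) \<Rightarrow> ('s \<times> 'a) bmfun \<Rightarrow> real \<Rightarrow>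
   'a measure \<Rightarrow> real \<Rightarrow> ('s \<Rightarrow> 'a measure) \<Rightarrow> 's \<Rightarrow> 'a \<Rightarrow> real" where
  "action_value P c \<gamma> \<mu> \<tau> \<pi> s a =
    c (s, a) + \<gamma> * (\<integral>s'. state_value P c \<gamma> \<mu> \<tau> \<pi> s' \<partial>P (s, a))"

end

theory Submission
  imports Defs
begin

text \<open>
  For \<open>f \<in> B\<^sub>b(S \<times> A)\<close> let \<open>V\<^sub>f\<close> be the value of the policy \<open>\<pi>\<^sub>f\<close>, let \<open>T\<^sub>f\<close> be the transition operator
  it induces on \<open>B\<^sub>b(S)\<close>, and put \<open>k\<^sub>f = c + \<gamma> P V\<^sub>f + \<tau> f\<close>. The Bellman equation reads
  \<open>V\<^sub>f = \<integral>k\<^sub>f d\<pi>\<^sub>f - \<tau> ln \<integral>exp f d\<mu>\<close>. Subtracting it for \<open>f\<close> and \<open>f + u\<close> gives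
  \<open>V\<^sub>f\<^sub>+\<^sub>u - V\<^sub>f = (I - \<gamma> T\<^sub>f\<^sub>+\<^sub>u)\<^sup>-\<^sup>1 R\<close>, where \<open>R\<close> equals the conditional covariance of \<open>k\<^sub>f\<close> and \<open>u\<close>
  under \<open>\<pi>\<^sub>f\<close> up to \<open>O(\<parallel>u\<parallel>\<^sup>2)\<close>. Hence \<open>f \<mapsto> V\<^sub>f\<close> is Frechet differentiable with derivative
  \<open>u \<mapsto> (I - \<gamma> T\<^sub>f)\<^sup>-\<^sup>1 Cov\<^sub>f(k\<^sub>f, u)\<close>. Along the flow \<open>k = V - \<partial>\<^sub>t Z\<close>, which extends to \<open>t = 0\<close> by
  continuity, and \<open>V\<close> does not depend on the action, so the derivative of \<open>V\<close> is
  \<open>-(I - \<gamma> T)\<^sup>-\<^sup>1 Var(\<partial>\<^sub>t Z) \<le> 0\<close>.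
\<close>

section \<open>The Banach algebra of bounded Borel functions\<close>

lemma bounded_mult_comp:
  fixes f g :: "'a \<Rightarrow> real"
  assumes "bounded (range f)" "bounded (range g)"
  shows "bounded (range (\<lambda>x. f x * g x))"
proof -
  obtain B C where B: "\<And>x. \<bar>f x\<bar> \<le> B" and C: "\<And>x. \<bar>g x\<bar> \<le> C"
    using assms unfolding bounded_iff by auto
  have "\<bar>f x * g x\<bar> \<le> B * C" for x
    unfolding abs_mult using B[of x] C[of x] by (intro mult_mono) auto
  then show ?thesis unfolding bounded_iff by auto
qed

text \<open>Products are needed to form conditional covariances as elements of the function space.
  Submultiplicativity of the sup norm gives their bounds.\<close>

instantiation bmfun :: (topological_space) real_normed_algebra
begin

lift_definition times_bmfun :: "'a bmfun \<Rightarrow> 'a bmfun \<Rightarrow> 'a bmfun" is "\<lambda>f g x. f x * g x"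
  by (auto intro: bounded_mult_comp)

lemmas times_bmfun_rep_eq [simp] = times_bmfun.rep_eq

instance
proof
  fix f g :: "'a bmfun"
  show "norm (f * g) \<le> norm f * norm g"
    by (rule norm_bmfun_le) (simp add: abs_mult abs_le_norm_bmfun mult_mono)
qed (auto intro!: bmfun_eqI simp: algebra_simps)

end

lemma bounded_linear_apply_bmfun: "bounded_linear (\<lambda>f. apply_bmfun f x)"
  by (rule bounded_linear_intro[of _ 1]) (auto simp: abs_le_norm_bmfun)

lemma apply_Bmfun:
  assumes "f \<in> borel_measurable borel" and "\<And>x. \<bar>f x\<bar> \<le> B"
  shows "apply_bmfun (Bmfun f) = f"
  using assms by (intro Bmfun_inverse) (auto simp: bounded_iff)

text \<open>A Cauchy sequence converges pointwise because the reals are complete. Letting one index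
  tend to infinity in the Cauchy bound makes the convergence uniform, and pointwise limits preserve
  Borel measurability. Completeness is what makes the Neumann series below converge.\<close>

instance bmfun :: (topological_space) banach
proof
  fix X :: "nat \<Rightarrow> 'a bmfun" assume X: "Cauchy X"
  have "Cauchy (\<lambda>n. apply_bmfun (X n) x)" for x
    using bounded_linear.Cauchy[OF bounded_linear_apply_bmfun X] .
  then have "convergent (\<lambda>n. apply_bmfun (X n) x)" for x
    by (simp add: Cauchy_convergent_iff)
  then obtain l where l: "(\<lambda>n. apply_bmfun (X n) x) \<longlonglongrightarrow> l x" for x
    unfolding convergent_def by metis
  have tail: "\<exists>N. \<forall>n\<ge>N. \<forall>x. \<bar>apply_bmfun (X n) x - l x\<bar> \<le> e" if e: "0 < e" for e
  proof -
    obtain N where N: "\<And>m n. m \<ge> N \<Longrightarrow> n \<ge> N \<Longrightarrow> norm (X m - X n) < e"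
      using CauchyD[OF X e] by blast
    have "\<bar>apply_bmfun (X n) x - l x\<bar> \<le> e" if "n \<ge> N" for n x
    proof (rule tendsto_upperbound)
      show "(\<lambda>m. \<bar>apply_bmfun (X n) x - apply_bmfun (X m) x\<bar>) \<longlonglongrightarrow> \<bar>apply_bmfun (X n) x - l x\<bar>"
        by (intro tendsto_intros l)
      show "\<forall>\<^sub>F m in sequentially. \<bar>apply_bmfun (X n) x - apply_bmfun (X m) x\<bar> \<le> e"
        using eventually_ge_at_top[of N]
      proof eventually_elim
        case (elim m)
        then show ?case
          using abs_le_norm_bmfun[of "X n - X m" x] N[OF that elim] by simp
      qed
    qed simp
    then show ?thesis by blast
  qed
  have l_meas: "l \<in> borel_measurable borel"
    by (rule borel_measurable_LIMSEQ_real[OF l]) simp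
  obtain N where N: "\<And>x. \<bar>apply_bmfun (X N) x - l x\<bar> \<le> 1"
    using tail[of 1] by auto
  have "\<bar>l x\<bar> \<le> norm (X N) + 1" for x
    using N[of x] abs_le_norm_bmfun[of "X N" x] by linarith
  note L = apply_Bmfun[OF l_meas this]
  have "X \<longlonglongrightarrow> Bmfun l"
  proof (rule LIMSEQ_I)
    fix r :: real assume "0 < r"
    then obtain N where N: "\<And>n x. n \<ge> N \<Longrightarrow> \<bar>apply_bmfun (X n) x - l x\<bar> \<le> r / 2"
      using tail[of "r / 2"] by auto
    have "norm (X n - Bmfun l) \<le> r / 2" if "n \<ge> N" for n
      using N[OF that] by (intro norm_bmfun_le) (simp add: L)
    then show "\<exists>N. \<forall>n\<ge>N. norm (X n - Bmfun l) < r"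
      using \<open>0 < r\<close> by (intro exI[of _ N]) fastforce
  qed
  then show "convergent X" by (rule convergentI)
qed

text \<open>Embeds functions of the state into functions of state and action, so that the value
  function and the entropy cost can be combined with \<open>c\<close> and the potential.\<close>

lift_definition state_fun :: "'s::topological_space bmfun \<Rightarrow> ('s \<times> 'a::topological_space) bmfun"
  is "\<lambda>f x. f (fst x)"
  by (auto intro: bounded_subset
      intro!: measurable_compose[OF borel_measurable_continuous_onI[OF continuous_on_fst[OF continuous_on_id]]])

lemmas state_fun_rep_eq [simp] = state_fun.rep_eq


section \<open>Markov operators\<close>

text \<open>\<open>Bmfun\<close> is specified only on bounded Borel functions, so the pointwise
  formula \<open>apply_markov_op\<close> is stated for measurable probability kernels.\<close>

definition markov_op ::
  "('a::topological_space \<Rightarrow> 'b::topological_space measure) \<Rightarrow> 'b bmfun \<Rightarrow> 'a bmfun" where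
  "markov_op \<kappa> h = Bmfun (\<lambda>x. \<integral>y. h y \<partial>\<kappa> x)"

lemma integrable_bmfun:
  fixes h :: "'a::topological_space bmfun"
  assumes "prob_space M" and "sets M = sets borel"
  shows "integrable M h"
proof -
  interpret prob_space M by fact
  show ?thesis
    by (rule integrable_const_bound[of _ "norm h"])
       (auto simp: abs_le_norm_bmfun measurable_cong_sets[OF assms(2) refl])
qed

lemma abs_integral_bmfun_le:
  fixes h :: "'a::topological_space bmfun"
  assumes "prob_space M" and "sets M = sets borel"
  shows "\<bar>\<integral>x. h x \<partial>M\<bar> \<le> norm h"
proof -
  interpret prob_space M by fact
  have "\<bar>\<integral>x. h x \<partial>M\<bar> \<le> (\<integral>x. \<bar>h x\<bar> \<partial>M)"
    by (rule integral_abs_bound)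
  also have "\<dots> \<le> (\<integral>x. norm h \<partial>M)"
    by (intro integral_mono integrable_abs integrable_bmfun assms) (auto simp: abs_le_norm_bmfun)
  finally show ?thesis by (simp add: prob_space)
qed

context
  fixes \<kappa> :: "'a::topological_space \<Rightarrow> 'b::topological_space measure"
  assumes \<kappa> [measurable]: "\<kappa> \<in> borel \<rightarrow>\<^sub>M prob_algebra borel"
begin

lemma kernel_prob_space: "prob_space (\<kappa> x)" and sets_kernel_borel: "sets (\<kappa> x) = sets borel"
  using measurable_space[OF \<kappa>, of x] by (auto simp: space_prob_algebra)

lemma apply_markov_op [simp]: "apply_bmfun (markov_op \<kappa> h) x = (\<integral>y. h y \<partial>\<kappa> x)"
proof -
  have [measurable]: "\<kappa> \<in> borel \<rightarrow>\<^sub>M subprob_algebra borel"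
    using \<kappa> by (rule measurable_prob_algebraD)
  have "(\<lambda>x. \<integral>y. h y \<partial>\<kappa> x) \<in> borel_measurable borel"
    by measurable
  then show ?thesis
    unfolding markov_op_def
    by (subst apply_Bmfun[where B = "norm h"])
       (simp_all add: abs_integral_bmfun_le kernel_prob_space sets_kernel_borel)
qed

lemma markov_op_nonneg: "(\<And>y. 0 \<le> apply_bmfun h y) \<Longrightarrow> 0 \<le> apply_bmfun (markov_op \<kappa> h) x"
  by (simp add: integral_nonneg_AE)

lemma norm_markov_op_le: "norm (markov_op \<kappa> h) \<le> norm h"
  by (rule norm_bmfun_le) (simp add: abs_integral_bmfun_le kernel_prob_space sets_kernel_borel)

lemma bounded_linear_markov_op: "bounded_linear (markov_op \<kappa>)"
proof (rule bounded_linear_intro[of _ 1])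
  have int: "integrable (\<kappa> x) (apply_bmfun h)" for x h
    by (intro integrable_bmfun kernel_prob_space sets_kernel_borel)
  show "markov_op \<kappa> (h + g) = markov_op \<kappa> h + markov_op \<kappa> g" for g h
    by (rule bmfun_eqI) (simp add: int)
  show "markov_op \<kappa> (r *\<^sub>R h) = r *\<^sub>R markov_op \<kappa> h" for r h
    by (rule bmfun_eqI) simp
qed (simp add: norm_markov_op_le)

end


section \<open>Discounted resolvents\<close>

text \<open>The Neumann series of the inverse of I - \<open>\<gamma>\<close> L.\<close>

definition resolvent :: "real \<Rightarrow> ('b::banach \<Rightarrow> 'b) \<Rightarrow> 'b \<Rightarrow> 'b" where
  "resolvent \<gamma> L w = (\<Sum>n. \<gamma> ^ n *\<^sub>R (L ^^ n) w)"

text \<open>A priori bound, obtained by absorbing \<open>\<gamma>\<close> times the norm of x into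
  the left-hand side. It gives the norm and the uniqueness of the resolvent, and later controls the
  Taylor remainder of the value.\<close>

lemma fixed_point_norm_le:
  fixes x w :: "'b::real_normed_vector"
  assumes "0 \<le> \<gamma>" "\<gamma> < 1" and L: "\<And>x. norm (L x) \<le> norm x" and x: "x = w + \<gamma> *\<^sub>R L x"
  shows "norm x \<le> norm w / (1 - \<gamma>)"
proof -
  have "norm x \<le> norm w + norm (\<gamma> *\<^sub>R L x)"
    by (subst x) (rule norm_triangle_ineq)
  also have "\<dots> \<le> norm w + \<gamma> * norm x"
    using \<open>0 \<le> \<gamma>\<close> L[of x] by (simp add: mult_left_mono)
  finally show ?thesis using \<open>\<gamma> < 1\<close> by (simp add: field_simps)
qed

context
  fixes \<gamma> :: real and L :: "'b::banach \<Rightarrow> 'b"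
  assumes \<gamma>: "0 \<le> \<gamma>" "\<gamma> < 1" and L: "bounded_linear L" and L_le: "\<And>x. norm (L x) \<le> norm x"
begin

lemma norm_funpow_le: "norm ((L ^^ n) w) \<le> norm w"
  by (induction n) (auto intro: order_trans[OF L_le])

lemma summable_resolvent: "summable (\<lambda>n. \<gamma> ^ n *\<^sub>R (L ^^ n) w)"
proof (rule summable_comparison_test)
  show "summable (\<lambda>n. \<gamma> ^ n * norm w)"
    using \<gamma> by (intro summable_mult2 summable_geometric) simp
  show "\<exists>N. \<forall>n\<ge>N. norm (\<gamma> ^ n *\<^sub>R (L ^^ n) w) \<le> \<gamma> ^ n * norm w"
    using \<gamma> by (auto simp: norm_funpow_le mult_left_mono)
qed

lemma resolvent_fixed_point: "resolvent \<gamma> L w = w + \<gamma> *\<^sub>R L (resolvent \<gamma> L w)"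
proof -
  interpret L: bounded_linear L by fact
  have "resolvent \<gamma> L w = w + (\<Sum>n. \<gamma> ^ Suc n *\<^sub>R (L ^^ Suc n) w)"
    unfolding resolvent_def
    by (subst suminf_split_head[OF summable_resolvent]) simp
  also have "(\<Sum>n. \<gamma> ^ Suc n *\<^sub>R (L ^^ Suc n) w) = (\<Sum>n. \<gamma> *\<^sub>R L (\<gamma> ^ n *\<^sub>R (L ^^ n) w))"
    by (simp add: L.scaleR)
  also have "\<dots> = \<gamma> *\<^sub>R L (resolvent \<gamma> L w)"
    unfolding resolvent_def
    by (simp add: suminf_scaleR_right L.suminf summable_resolvent L.summable)
  finally show ?thesis .
qed

lemma norm_resolvent_le: "norm (resolvent \<gamma> L w) \<le> norm w / (1 - \<gamma>)"
  by (rule fixed_point_norm_le[OF \<gamma> L_le resolvent_fixed_point])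

text \<open>The difference of two solutions solves the equation with zero source, so the a priori
  bound forces it to vanish.\<close>

lemma resolvent_unique:
  assumes "x = w + \<gamma> *\<^sub>R L x"
  shows "x = resolvent \<gamma> L w"
proof -
  interpret L: bounded_linear L by fact
  note arg_cong2[OF assms resolvent_fixed_point, of "(-)"]
  also have "w + \<gamma> *\<^sub>R L x - (w + \<gamma> *\<^sub>R L (resolvent \<gamma> L w)) =
      0 + \<gamma> *\<^sub>R L (x - resolvent \<gamma> L w)"
    by (simp add: L.diff scaleR_diff_right)
  finally have "x - resolvent \<gamma> L w = 0 + \<gamma> *\<^sub>R L (x - resolvent \<gamma> L w)" .
  from fixed_point_norm_le[OF \<gamma> L_le this] show ?thesis by simp
qed

text \<open>Linearity follows from uniqueness: sums and multiples of solutions solve the equation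
  with the corresponding source.\<close>

lemma bounded_linear_resolvent: "bounded_linear (resolvent \<gamma> L)"
proof (rule bounded_linear_intro)
  interpret L: bounded_linear L by fact
  show "resolvent \<gamma> L (v + w) = resolvent \<gamma> L v + resolvent \<gamma> L w" for v w
    by (rule resolvent_unique[symmetric],
        rule trans[OF arg_cong2[OF resolvent_fixed_point resolvent_fixed_point, of "(+)"]])
       (simp add: L.add algebra_simps)
  show "resolvent \<gamma> L (r *\<^sub>R w) = r *\<^sub>R resolvent \<gamma> L w" for r w
    by (rule resolvent_unique[symmetric],
        rule trans[OF arg_cong[OF resolvent_fixed_point, of "scaleR r"]])
       (simp add: L.scaleR algebra_simps)
  show "norm (resolvent \<gamma> L w) \<le> norm w * (1 / (1 - \<gamma>))" for w
    using norm_resolvent_le[of w] by simp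
qed

end

text \<open>Every term of the Neumann series is nonnegative, and evaluation at a point is bounded
  linear, hence commutes with the sum.\<close>

lemma resolvent_nonneg:
  fixes L :: "'a::topological_space bmfun \<Rightarrow> 'a bmfun"
  assumes "0 \<le> \<gamma>" "\<gamma> < 1" "bounded_linear L" "\<And>x. norm (L x) \<le> norm x"
    and L_nonneg: "\<And>h x. (\<And>y. 0 \<le> apply_bmfun h y) \<Longrightarrow> 0 \<le> apply_bmfun (L h) x"
    and h: "\<And>y. 0 \<le> apply_bmfun h y"
  shows "0 \<le> apply_bmfun (resolvent \<gamma> L h) x"
proof -
  interpret ev: bounded_linear "\<lambda>f. apply_bmfun f x" by (rule bounded_linear_apply_bmfun)
  have "0 \<le> apply_bmfun ((L ^^ n) h) y" for n y
    by (induction n arbitrary: y) (auto intro: h L_nonneg)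
  moreover note summable = summable_resolvent[OF assms(1-4), of h]
  ultimately show ?thesis
    unfolding resolvent_def ev.suminf[OF summable]
    using \<open>0 \<le> \<gamma>\<close> by (intro suminf_nonneg ev.summable[OF summable]) simp
qed

text \<open>After division by the norm of u the remainder is squeezed between 0 and C times that
  norm.\<close>

lemma has_derivative_quadratic_remainder:
  fixes f :: "'a::real_normed_vector \<Rightarrow> 'b::real_normed_vector"
  assumes D: "bounded_linear D"
    and rem: "\<And>u. norm u \<le> 1 \<Longrightarrow> norm (f (x + u) - f x - D u) \<le> C * (norm u)\<^sup>2"
  shows "(f has_derivative D) (at x)"
  unfolding has_derivative_at
proof (intro conjI D)
  show "(\<lambda>u. norm (f (x + u) - f x - D u) / norm u) \<midarrow>0\<rightarrow> 0"
  proof (rule real_tendsto_sandwich[where f = "\<lambda>_. 0"])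
    have "(\<lambda>u::'a. C * norm u) \<midarrow>0\<rightarrow> C * norm (0::'a)"
      by (intro tendsto_intros)
    then show "(\<lambda>u::'a. C * norm u) \<midarrow>0\<rightarrow> 0" by simp
    have "\<forall>\<^sub>F u::'a in at 0. norm u < 1"
      by (auto simp: eventually_at intro!: exI[of _ 1])
    then show "\<forall>\<^sub>F u in at 0. norm (f (x + u) - f x - D u) / norm u \<le> C * norm u"
    proof eventually_elim
      case (elim u)
      then have "norm (f (x + u) - f x - D u) / norm u \<le> C * (norm u)\<^sup>2 / norm u"
        by (intro divide_right_mono rem) auto
      also have "\<dots> = C * norm u" by (simp add: power2_eq_square)
      finally show ?case .
    qed
  qed auto
qed


section \<open>Exponential tilting of a probability measure\<close>

lemma abs_exp_remainder_le:
  fixes x :: real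
  assumes "\<bar>x\<bar> \<le> 1"
  shows "\<bar>exp x - 1 - x\<bar> \<le> x\<^sup>2"
proof -
  have "exp x \<le> 1 + x + x\<^sup>2"
  proof (cases "0 \<le> x")
    case True
    with assms show ?thesis by (intro exp_bound) auto
  next
    case False
    define y where "y = - x"
    have y: "0 < y" "y \<le> 1" using False assms by (auto simp: y_def)
    \<comment> \<open>The first factor is the quadratic Taylor polynomial below exp y. Since the
      product is at least 1, the second factor dominates exp (-y).\<close>
    have "(1 + y + y\<^sup>2 / 2) * (1 - y + y\<^sup>2) = 1 + (y ^ 2 + y ^ 3 + y ^ 4) / 2"
      by (simp add: power2_eq_square power3_eq_cube power4_eq_xxxx field_simps)
    then have "1 \<le> (1 + y + y\<^sup>2 / 2) * (1 - y + y\<^sup>2)"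
      using y by (simp add: add_nonneg_nonneg)
    also have "\<dots> \<le> exp y * (1 - y + y\<^sup>2)"
      using y exp_lower_Taylor_quadratic[of y] by (intro mult_right_mono) (auto simp: add_nonneg_nonneg)
    finally show ?thesis by (simp add: y_def exp_minus field_simps)
  qed
  then show ?thesis using exp_ge_add_one_self[of x] zero_le_power2[of x] by linarith
qed

context prob_space
begin

lemma integrable_bounded:
  fixes f :: "'a \<Rightarrow> real"
  assumes "f \<in> borel_measurable M" and "\<And>x. \<bar>f x\<bar> \<le> B"
  shows "integrable M f"
  using assms by (intro integrable_const_bound[of _ B]) auto

lemma abs_integral_le:
  fixes f :: "'a \<Rightarrow> real"
  assumes "f \<in> borel_measurable M" and f: "\<And>x. \<bar>f x\<bar> \<le> B"
  shows "\<bar>\<integral>x. f x \<partial>M\<bar> \<le> B"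
proof -
  have "\<bar>\<integral>x. f x \<partial>M\<bar> \<le> (\<integral>x. \<bar>f x\<bar> \<partial>M)"
    by (rule integral_abs_bound)
  also have "\<dots> \<le> (\<integral>x. B \<partial>M)"
    using assms by (intro integral_mono integrable_abs integrable_bounded[of f B]) auto
  finally show ?thesis by (simp add: prob_space)
qed

text \<open>Replace exp u by 1 + u, with error at most \<open>\<delta>\<^sup>2\<close>. The first
  bound expands the cumulant generating function to first order. The second expands the mean of h
  under the measure tilted by exp u, whose first-order term is the covariance of h and u.\<close>

lemma exp_moment_estimates:
  fixes u h :: "'a \<Rightarrow> real"
  assumes [measurable]: "u \<in> borel_measurable M" "h \<in> borel_measurable M"
    and u: "\<And>x. \<bar>u x\<bar> \<le> \<delta>" and "\<delta> \<le> 1" and h: "\<And>x. \<bar>h x\<bar> \<le> H"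
  shows "\<bar>ln (\<integral>x. exp (u x) \<partial>M) - (\<integral>x. u x \<partial>M)\<bar> \<le> \<delta>\<^sup>2"
    and "\<bar>(\<integral>x. h x * exp (u x) \<partial>M) / (\<integral>x. exp (u x) \<partial>M) - (\<integral>x. h x \<partial>M)
        - ((\<integral>x. h x * u x \<partial>M) - (\<integral>x. h x \<partial>M) * (\<integral>x. u x \<partial>M))\<bar> \<le> 18 * H * \<delta>\<^sup>2"
proof -
  have \<delta>: "0 \<le> \<delta>" and H: "0 \<le> H"
    using order_trans[OF abs_ge_zero u] order_trans[OF abs_ge_zero h] by auto
  define E m \<rho> a b N R where "E = (\<integral>x. exp (u x) \<partial>M)" and "m = (\<integral>x. u x \<partial>M)"
    and "\<rho> = E - 1 - m" and "a = (\<integral>x. h x \<partial>M)" and "b = (\<integral>x. h x * u x \<partial>M)"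
    and "N = (\<integral>x. h x * exp (u x) \<partial>M)" and "R = N - a - b"
  have exp_u: "\<bar>exp (u x)\<bar> \<le> exp 1" for x using u[of x] \<open>\<delta> \<le> 1\<close> by simp
  have hu: "\<bar>h x * u x\<bar> \<le> H * \<delta>" for x
    unfolding abs_mult using u h H by (intro mult_mono) auto
  have hexp: "\<bar>h x * exp (u x)\<bar> \<le> H * exp 1" for x
    unfolding abs_mult using exp_u h H by (intro mult_mono) auto
  have int: "integrable M u" "integrable M h" "integrable M (\<lambda>x. exp (u x))"
    "integrable M (\<lambda>x. h x * u x)" "integrable M (\<lambda>x. h x * exp (u x))"
    by (rule integrable_bounded[OF _ u] integrable_bounded[OF _ h] integrable_bounded[OF _ exp_u]
        integrable_bounded[OF _ hu] integrable_bounded[OF _ hexp], measurable)+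
  have rem: "\<bar>exp (u x) - 1 - u x\<bar> \<le> \<delta>\<^sup>2" for x
    using abs_exp_remainder_le[of "u x"] u[of x] \<open>\<delta> \<le> 1\<close> abs_le_square_iff[of "u x" \<delta>] by simp
  have m: "\<bar>m\<bar> \<le> \<delta>" and a: "\<bar>a\<bar> \<le> H" and b: "\<bar>b\<bar> \<le> H * \<delta>"
    unfolding m_def a_def b_def
    by (rule abs_integral_le[OF _ u] abs_integral_le[OF _ h] abs_integral_le[OF _ hu], measurable)+
  have "\<rho> = (\<integral>x. exp (u x) - 1 - u x \<partial>M)"
    unfolding \<rho>_def E_def m_def using int by (simp add: prob_space)
  also have "\<bar>\<dots>\<bar> \<le> \<delta>\<^sup>2"
    by (rule abs_integral_le[OF _ rem]) measurable
  finally have \<rho>: "\<bar>\<rho>\<bar> \<le> \<delta>\<^sup>2" .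
  have "R = (\<integral>x. h x * (exp (u x) - 1 - u x) \<partial>M)"
    unfolding R_def N_def a_def b_def using int by (simp add: right_diff_distrib)
  also have "\<bar>\<dots>\<bar> \<le> H * \<delta>\<^sup>2"
  proof (rule abs_integral_le)
    show "\<bar>h x * (exp (u x) - 1 - u x)\<bar> \<le> H * \<delta>\<^sup>2" for x
      unfolding abs_mult using h rem H by (intro mult_mono) auto
  qed measurable
  finally have R: "\<bar>R\<bar> \<le> H * \<delta>\<^sup>2" .
  \<comment> \<open>The tangent of exp at the mean m lies below exp; integrating it gives Jensen's
    inequality exp m <= E.\<close>
  have "exp m * (1 + (u x - m)) \<le> exp (u x)" for x
  proof -
    have "exp m * (1 + (u x - m)) \<le> exp m * exp (u x - m)"
      using exp_ge_add_one_self[of "u x - m"] by (intro mult_left_mono) auto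
    then show ?thesis by (simp flip: exp_add)
  qed
  then have "(\<integral>x. exp m * (1 + (u x - m)) \<partial>M) \<le> E"
    unfolding E_def using int by (intro integral_mono) auto
  then have jensen: "exp m \<le> E"
    using int by (simp add: prob_space m_def[symmetric])
  then have E_pos: "0 < E" using less_le_trans[OF exp_gt_zero] by blast
  have "ln E \<le> m + \<delta>\<^sup>2"
    using ln_le_minus_one[OF E_pos] \<rho> by (simp add: \<rho>_def)
  moreover have "m \<le> ln E" using jensen E_pos by (simp add: ln_ge_iff)
  ultimately show "\<bar>ln (\<integral>x. exp (u x) \<partial>M) - (\<integral>x. u x \<partial>M)\<bar> \<le> \<delta>\<^sup>2"
    by (simp add: E_def m_def)
  \<comment> \<open>The normaliser stays away from 0: m >= -1 and e <= 3, so Jensen gives E >=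
    1/3.\<close>
  have "exp (- 1) \<le> exp m" using m \<open>\<delta> \<le> 1\<close> by simp
  moreover have "1 / 3 \<le> exp (- 1 :: real)"
    using exp_bound[of "1::real"] by (simp add: exp_minus field_simps)
  ultimately have E_ge: "1 / 3 \<le> E" using jensen by linarith
  have "\<delta>\<^sup>2 \<le> \<delta>" using \<delta> \<open>\<delta> \<le> 1\<close> by (simp add: power2_eq_square mult_left_le)
  then have m\<rho>: "\<bar>m + \<rho>\<bar> \<le> 2 * \<delta>" using m \<rho> by linarith
  \<comment> \<open>Clearing the denominator cancels all terms of order zero and one. The four that
    remain are bounded by 1, 1, 2 and 2 times H \<open>\<delta>\<^sup>2\<close>. Dividing the total
    6 by 1/3 yields the constant 18.\<close>
  have "N - E * (a + (b - a * m)) = R - \<rho> * a - (m + \<rho>) * b + (m + \<rho>) * (a * m)"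
    unfolding R_def \<rho>_def by (simp add: algebra_simps)
  also have "\<bar>\<dots>\<bar> \<le> \<bar>R\<bar> + \<bar>\<rho>\<bar> * \<bar>a\<bar> + \<bar>m + \<rho>\<bar> * \<bar>b\<bar> + \<bar>m + \<rho>\<bar> * (\<bar>a\<bar> * \<bar>m\<bar>)"
    unfolding abs_mult[symmetric] by linarith
  also have "\<dots> \<le> H * \<delta>\<^sup>2 + \<delta>\<^sup>2 * H + 2 * \<delta> * (H * \<delta>) + 2 * \<delta> * (H * \<delta>)"
    using R \<rho> a b m m\<rho> H \<delta> by (intro add_mono mult_mono) auto
  also have "\<dots> = 6 * H * \<delta>\<^sup>2" by (simp add: power2_eq_square)
  finally have num: "\<bar>N - E * (a + (b - a * m))\<bar> \<le> 6 * H * \<delta>\<^sup>2" .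
  have "\<bar>N / E - a - (b - a * m)\<bar> = \<bar>N - E * (a + (b - a * m))\<bar> / E"
    using E_pos by (simp add: abs_if field_simps)
  also have "\<dots> \<le> 6 * H * \<delta>\<^sup>2 / (1 / 3)"
    using num E_ge H by (intro frac_le) auto
  finally show "\<bar>(\<integral>x. h x * exp (u x) \<partial>M) / (\<integral>x. exp (u x) \<partial>M) - (\<integral>x. h x \<partial>M)
      - ((\<integral>x. h x * u x \<partial>M) - (\<integral>x. h x \<partial>M) * (\<integral>x. u x \<partial>M))\<bar> \<le> 18 * H * \<delta>\<^sup>2"
    by (simp add: N_def E_def a_def b_def m_def)
qed

lemma variance_nonneg_bounded:
  fixes u :: "'a \<Rightarrow> real"
  assumes [measurable]: "u \<in> borel_measurable M" and u: "\<And>x. \<bar>u x\<bar> \<le> B"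
  shows "(\<integral>x. u x \<partial>M) * (\<integral>x. u x \<partial>M) \<le> (\<integral>x. u x * u x \<partial>M)"
proof -
  have uu: "\<bar>u x * u x\<bar> \<le> B * B" for x
    unfolding abs_mult using u order_trans[OF abs_ge_zero u] by (intro mult_mono) auto
  have int: "integrable M u" "integrable M (\<lambda>x. (u x)\<^sup>2)"
    by (rule integrable_bounded[OF _ u], simp)
       (rule integrable_bounded[OF _ uu[unfolded power2_eq_square[symmetric]]], measurable)
  show ?thesis
    using variance_positive[of u] unfolding variance_eq[OF int] by (simp add: power2_eq_square)
qed

end


section \<open>Softmax policies\<close>

lemma section_measurable [measurable]:
  fixes f :: "('s::topological_space \<times> 'a::topological_space) bmfun"
  shows "(\<lambda>a. f (s, a)) \<in> borel_measurable borel"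
  by (rule measurable_compose[OF borel_measurable_continuous_onI apply_bmfun_measurable])
     (intro continuous_intros)

lemma measurable_draw_action:
  assumes "\<pi> \<in> borel \<rightarrow>\<^sub>M prob_algebra borel"
  shows "draw_action \<pi> \<in> borel \<rightarrow>\<^sub>M prob_algebra borel"
  unfolding draw_action_def
  by (rule measurable_distr_prob_space2[OF assms]) (simp add: borel_prod case_prod_unfold)

lemma integral_draw_action:
  assumes "sets (\<pi> s) = sets borel"
  shows "(\<integral>x. apply_bmfun h x \<partial>draw_action \<pi> s) = (\<integral>a. h (s, a) \<partial>\<pi> s)"
  unfolding draw_action_def
  by (rule integral_distr)
     (auto intro!: borel_measurable_continuous_onI continuous_intros
        simp: measurable_cong_sets[OF assms refl])

locale action_space = prob_space \<mu> for \<mu> :: "'a::polish_space measure" +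
  assumes sets_\<mu> [measurable_cong]: "sets \<mu> = sets borel"
begin

text \<open>Averaging over actions is written as the Markov operator of the kernel sending s to the
  law of (s, a), so linearity, contraction and positivity are inherited from
  \<open>markov_op\<close>.\<close>

definition policy_op :: "('s::polish_space \<times> 'a) bmfun \<Rightarrow> ('s \<times> 'a) bmfun \<Rightarrow> 's bmfun" where
  "policy_op f = markov_op (draw_action (softmax_policy \<mu> f))"

definition policy_cov ::
  "('s::polish_space \<times> 'a) bmfun \<Rightarrow> ('s \<times> 'a) bmfun \<Rightarrow> ('s \<times> 'a) bmfun \<Rightarrow> 's bmfun" where
  "policy_cov f h u = policy_op f (h * u) - policy_op f h * policy_op f u"

definition partition_fun :: "('s::polish_space \<times> 'a) bmfun \<Rightarrow> 's \<Rightarrow> real" where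
  "partition_fun f s = (\<integral>a. exp (f (s, a)) \<partial>\<mu>)"

definition log_partition :: "('s::polish_space \<times> 'a) bmfun \<Rightarrow> 's bmfun" where
  "log_partition f = Bmfun (\<lambda>s. ln (partition_fun f s))"

lemma softmax_measurable: "softmax_policy \<mu> f \<in> borel \<rightarrow>\<^sub>M prob_algebra borel"
  by (rule softmax_policy_kernel[OF prob_space_axioms sets_\<mu>])

lemmas prob_space_softmax = kernel_prob_space[OF softmax_measurable]
  and sets_softmax [measurable_cong] = sets_kernel_borel[OF softmax_measurable]
  and draw_softmax_measurable = measurable_draw_action[OF softmax_measurable]

lemma apply_policy_op [simp]:
  "apply_bmfun (policy_op f h) s = (\<integral>a. h (s, a) \<partial>softmax_policy \<mu> f s)"
  by (simp add: policy_op_def draw_softmax_measurable integral_draw_action sets_softmax)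

lemmas bounded_linear_policy_op = bounded_linear_markov_op[OF draw_softmax_measurable, folded policy_op_def]
  and norm_policy_op_le = norm_markov_op_le[OF draw_softmax_measurable, folded policy_op_def]
  and policy_op_nonneg = markov_op_nonneg[OF draw_softmax_measurable, folded policy_op_def]

lemma policy_op_state_fun [simp]: "policy_op f (state_fun W) = W"
  by (rule bmfun_eqI) (simp add: prob_space.prob_space[OF prob_space_softmax])

lemma abs_section_le: "\<bar>apply_bmfun f (s, a)\<bar> \<le> norm f"
  by (rule abs_le_norm_bmfun)

lemma integrable_exp_section: "integrable \<mu> (\<lambda>a. exp (apply_bmfun f (s, a)))"
  using abs_section_le[of f s] by (intro integrable_bounded[of _ "exp (norm f)"]) (auto simp: abs_le_iff)

lemma partition_fun_bounds: "exp (- norm f) \<le> partition_fun f s" "partition_fun f s \<le> exp (norm f)"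
proof -
  have "(\<integral>a. exp (- norm f) \<partial>\<mu>) \<le> partition_fun f s"
    unfolding partition_fun_def using abs_section_le[of f s]
    by (intro integral_mono integrable_exp_section) (auto simp: abs_le_iff minus_le_iff)
  then show "exp (- norm f) \<le> partition_fun f s" by (simp add: prob_space)
  have "partition_fun f s \<le> (\<integral>a. exp (norm f) \<partial>\<mu>)"
    unfolding partition_fun_def using abs_section_le[of f s]
    by (intro integral_mono integrable_exp_section) (auto simp: abs_le_iff)
  then show "partition_fun f s \<le> exp (norm f)" by (simp add: prob_space)
qed

lemma partition_fun_pos: "0 < partition_fun f s"
  using partition_fun_bounds(1)[of f s] less_le_trans[OF exp_gt_zero] by blast

lemma partition_fun_measurable [measurable]: "partition_fun f \<in> borel_measurable borel"
proof -
  have [measurable]: "apply_bmfun f \<in> borel_measurable (borel \<Otimes>\<^sub>M borel)"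
    by (simp add: borel_prod)
  show ?thesis unfolding partition_fun_def by measurable
qed

lemma apply_log_partition [simp]: "apply_bmfun (log_partition f) s = ln (partition_fun f s)"
proof -
  have "\<bar>ln (partition_fun f s)\<bar> \<le> norm f" for s
  proof -
    have "- norm f \<le> ln (partition_fun f s)" "ln (partition_fun f s) \<le> norm f"
      using partition_fun_bounds[of f s] partition_fun_pos[of f s]
      by (simp_all add: ln_ge_iff ln_le_cancel_iff[of _ "exp (norm f)", simplified])
    then show ?thesis by (simp add: abs_le_iff)
  qed
  then show ?thesis
    unfolding log_partition_def by (subst apply_Bmfun[where B = "norm f"]) auto
qed

lemma softmax_policy_eq:
  "softmax_policy \<mu> f s = density \<mu> (\<lambda>a. ennreal (exp (f (s, a)) / partition_fun f s))"
  by (simp add: softmax_policy_def partition_fun_def)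

lemma integral_softmax:
  assumes [measurable]: "\<phi> \<in> borel_measurable borel"
  shows "(\<integral>a. \<phi> a \<partial>softmax_policy \<mu> f s) = (\<integral>a. exp (f (s, a)) * \<phi> a \<partial>\<mu>) / partition_fun f s"
  unfolding softmax_policy_eq
  by (subst integral_real_density) (auto simp: partition_fun_pos less_imp_le)

text \<open>The policy of f + u has density proportional to exp u with respect to the policy of f.
  Comparing the two policies is therefore the tilting problem of
  \<open>exp_moment_estimates\<close>.\<close>

lemma softmax_tilt:
  "(\<integral>a. exp (apply_bmfun u (s, a)) \<partial>softmax_policy \<mu> f s) = partition_fun (f + u) s / partition_fun f s"
  "(\<integral>a. apply_bmfun h (s, a) \<partial>softmax_policy \<mu> (f + u) s) =
    (\<integral>a. apply_bmfun h (s, a) * exp (apply_bmfun u (s, a)) \<partial>softmax_policy \<mu> f s) /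
    (\<integral>a. exp (apply_bmfun u (s, a)) \<partial>softmax_policy \<mu> f s)"
proof -
  show *: "(\<integral>a. exp (apply_bmfun u (s, a)) \<partial>softmax_policy \<mu> f s) = partition_fun (f + u) s / partition_fun f s"
    by (subst integral_softmax) (auto simp: partition_fun_def exp_add)
  show "(\<integral>a. apply_bmfun h (s, a) \<partial>softmax_policy \<mu> (f + u) s) =
    (\<integral>a. apply_bmfun h (s, a) * exp (apply_bmfun u (s, a)) \<partial>softmax_policy \<mu> f s) /
    (\<integral>a. exp (apply_bmfun u (s, a)) \<partial>softmax_policy \<mu> f s)"
    unfolding * using partition_fun_pos[of f s]
    by (simp add: integral_softmax exp_add ac_simps)
qed

text \<open>The moment estimates are applied at each state to the policy of f. Their bounds involve
  only the sup norms of u and h, so they are uniform in the state.\<close>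

lemma
  assumes u: "norm u \<le> 1"
  shows log_partition_expansion:
      "norm (log_partition (f + u) - log_partition f - policy_op f u) \<le> (norm u)\<^sup>2"
    and policy_op_expansion:
      "norm (policy_op (f + u) h - policy_op f h - policy_cov f h u) \<le> 18 * norm h * (norm u)\<^sup>2"
proof -
  let ?L = "log_partition (f + u) - log_partition f - policy_op f u"
  let ?P = "policy_op (f + u) h - policy_op f h - policy_cov f h u"
  have bounds: "\<bar>?L s\<bar> \<le> (norm u)\<^sup>2 \<and> \<bar>?P s\<bar> \<le> 18 * norm h * (norm u)\<^sup>2" for s
  proof -
    note est = prob_space.exp_moment_estimates[where u = "\<lambda>a. apply_bmfun u (s, a)" and \<delta> = "norm u"
        and h = "\<lambda>a. apply_bmfun h (s, a)" and H = "norm h",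
        OF prob_space_softmax[of f s] _ _ abs_section_le u abs_section_le, simplified]
    have "ln (\<integral>a. exp (u (s, a)) \<partial>softmax_policy \<mu> f s) =
        ln (partition_fun (f + u) s) - ln (partition_fun f s)"
      using partition_fun_pos[of f s] partition_fun_pos[of "f + u" s]
      by (simp add: softmax_tilt ln_div)
    with est show ?thesis by (simp add: softmax_tilt(2) policy_cov_def)
  qed
  then show "norm ?L \<le> (norm u)\<^sup>2" and "norm ?P \<le> 18 * norm h * (norm u)\<^sup>2"
    by (auto intro!: norm_bmfun_le simp del: bmfun_rep_eqs)
qed

lemma norm_policy_cov_le: "norm (policy_cov f h u) \<le> 2 * norm h * norm u"
proof -
  have "norm (policy_cov f h u) \<le> norm (policy_op f (h * u)) + norm (policy_op f h * policy_op f u)"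
    unfolding policy_cov_def by (rule norm_triangle_ineq4)
  also have "\<dots> \<le> norm h * norm u + norm h * norm u"
    by (intro add_mono order_trans[OF norm_policy_op_le norm_mult_ineq]
        order_trans[OF norm_mult_ineq mult_mono[OF norm_policy_op_le norm_policy_op_le]]) auto
  finally show ?thesis by simp
qed

lemma bounded_linear_policy_cov: "bounded_linear (policy_cov f h)"
  unfolding policy_cov_def[abs_def]
  by (intro bounded_linear_sub bounded_linear_compose[OF bounded_linear_policy_op bounded_linear_mult_right]
      bounded_linear_compose[OF bounded_linear_mult_right bounded_linear_policy_op])

lemma policy_cov_self_nonneg: "0 \<le> apply_bmfun (policy_cov f u u) s"
  using prob_space.variance_nonneg_bounded[where u = "\<lambda>a. apply_bmfun u (s, a)" and B = "norm u",
      OF prob_space_softmax[of f s] _ abs_section_le]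
  by (simp add: policy_cov_def)

text \<open>Given the state, a function of the state alone is constant, so its conditional
  covariance with u vanishes.\<close>

lemma policy_cov_state_fun_diff: "policy_cov f (state_fun W - u) u = - policy_cov f u u"
proof -
  interpret L: bounded_linear "policy_op f" by (rule bounded_linear_policy_op)
  have "policy_op f (state_fun W * u) = W * policy_op f u"
    by (rule bmfun_eqI) simp
  then show ?thesis
    by (simp add: policy_cov_def left_diff_distrib L.diff)
qed

text \<open>The log-density of the policy is f minus the log-partition function; integrate it
  against the policy. Finiteness of the relative entropy rules out the infinite branch of
  \<open>KL\<close>.\<close>

lemma KL_softmax:
  "real_of_ereal (KL (softmax_policy \<mu> f s) \<mu>) = (policy_op f f - log_partition f) s"
proof -
  define g where "g a = exp (apply_bmfun f (s, a)) / partition_fun f s" for a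
  have [measurable]: "g \<in> borel_measurable borel"
    unfolding g_def by measurable
  have "KL (softmax_policy \<mu> f s) \<mu> < \<infinity>"
    by (rule softmax_policy_kernel[OF prob_space_axioms sets_\<mu>])
  then have "real_of_ereal (KL (softmax_policy \<mu> f s) \<mu>) = KL_divergence (exp 1) \<mu> (softmax_policy \<mu> f s)"
    by (auto simp: KL_def split: if_splits)
  also have "\<dots> = (\<integral>a. g a * log (exp 1) (g a) \<partial>\<mu>)"
    unfolding softmax_policy_eq g_def[symmetric]
    by (rule KL_density) (auto simp: g_def partition_fun_pos less_imp_le)
  also have "\<dots> = (\<integral>a. exp (f (s, a)) * (f (s, a) - ln (partition_fun f s)) \<partial>\<mu>) / partition_fun f s"
    using partition_fun_pos[of f s]
    by (simp add: g_def log_def ln_div flip: integral_divide_zero)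
  also have "\<dots> = (\<integral>a. f (s, a) - ln (partition_fun f s) \<partial>softmax_policy \<mu> f s)"
    by (subst integral_softmax) auto
  also have "\<dots> = (policy_op f f - log_partition f) s"
  proof -
    interpret S: prob_space "softmax_policy \<mu> f s" by (rule prob_space_softmax)
    have "integrable (softmax_policy \<mu> f s) (\<lambda>a. f (s, a))"
      by (rule S.integrable_bounded[OF _ abs_section_le]) measurable
    then show ?thesis by (simp add: S.prob_space)
  qed
  finally show ?thesis .
qed

end


section \<open>Values along trajectories\<close>

context Ionescu_Tulcea
begin

text \<open>\<open>CI\<close> on an index set runs the process up to \<open>up_to\<close> of that
  set; on an initial segment it thus runs exactly n steps.\<close>

lemma up_to_atLeastLessThan: "up_to {0..<n} = n"
proof (rule antisym)
  show "up_to {0..<n} \<le> n" by (simp add: up_to_iff_Ico)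
  have "{0..<n} \<subseteq> {0..<up_to {0..<n}}" by (intro up_to) simp
  then show "n \<le> up_to {0..<n}" by (cases n) auto
qed

text \<open>The marginal of the projective limit on the first n coordinates is the law of n steps of
  the process.\<close>

lemma integral_lim_eq_integral_C:
  fixes \<phi> :: "(nat \<Rightarrow> 'a) \<Rightarrow> real"
  assumes [measurable]: "\<phi> \<in> borel_measurable (PiM {0..<n} M)"
  shows "(\<integral>\<omega>. \<phi> (restrict \<omega> {0..<n}) \<partial>PF.lim) = (\<integral>\<omega>. \<phi> \<omega> \<partial>C 0 n (\<lambda>_. undefined))"
proof -
  have [measurable]: "(\<lambda>\<omega>. restrict \<omega> {0..<n}) \<in> PF.lim \<rightarrow>\<^sub>M PiM {0..<n} M"
    unfolding measurable_cong_sets[OF PF.sets_lim refl] by (rule measurable_restrict_subset) simp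
  have "(\<integral>\<omega>. \<phi> (restrict \<omega> {0..<n}) \<partial>PF.lim) = (\<integral>\<omega>. \<phi> \<omega> \<partial>CI {0..<n})"
    by (subst distr_lim[symmetric], simp, subst integral_distr) auto
  also have "CI {0..<n} = C 0 n (\<lambda>_. undefined)"
    using distr_C[of n n "\<lambda>_. undefined" 0] by (simp add: CI_def up_to_atLeastLessThan)
  finally show ?thesis .
qed

text \<open>The last step appends one coordinate drawn from the kernel \<open>P n\<close>, and the
  integrand sees only that coordinate.\<close>

lemma integral_C_Suc:
  fixes h :: "'a \<Rightarrow> real"
  assumes h [measurable]: "h \<in> borel_measurable (M n)" and B: "\<And>x. \<bar>h x\<bar> \<le> B"
  shows "(\<integral>\<omega>. h (\<omega> n) \<partial>C 0 (Suc n) (\<lambda>_. undefined)) =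
    (\<integral>\<omega>. (\<integral>x. h x \<partial>P n \<omega>) \<partial>C 0 n (\<lambda>_. undefined))"
proof -
  let ?u = "\<lambda>_. undefined :: 'a"
  interpret C: prob_space "C 0 n ?u" by (rule prob_space_C) simp
  have sets: "sets (C 0 n ?u) = sets (PiM {0..<n} M)"
    using sets_C[of ?u 0 n] by simp
  have meas: "(\<lambda>\<omega>. h (\<omega> n)) \<in> borel_measurable (PiM {0..<Suc n} M)"
    by measurable
  have kernel: "eP n \<in> C 0 n ?u \<rightarrow>\<^sub>M subprob_algebra (PiM {0..<Suc n} M)"
    using measurable_eP by (simp add: measurable_cong_sets[OF sets refl])
  have eP_space: "\<omega> \<in> space (PiM {0..<n} M)" if "\<omega> \<in> space (C 0 n ?u)" for \<omega>
    using that sets_eq_imp_space_eq[OF sets] by simp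
  have "(\<integral>\<omega>. h (\<omega> n) \<partial>C 0 (Suc n) ?u) = (\<integral>\<omega>. (\<integral>\<omega>'. h (\<omega>' n) \<partial>eP n \<omega>) \<partial>C 0 n ?u)"
    unfolding C.simps add_0
  proof (rule integral_bind[OF meas B kernel C.finite_measure_axioms, where B' = 1])
    show "AE \<omega> in C 0 n ?u. emeasure (eP n \<omega>) (space (eP n \<omega>)) \<le> ennreal 1"
      by (intro AE_I2) (simp add: prob_space.emeasure_space_1[OF prob_space_eP] eP_space)
  qed
  also have "\<dots> = (\<integral>\<omega>. (\<integral>x. h x \<partial>P n \<omega>) \<partial>C 0 n ?u)"
  proof (rule Bochner_Integration.integral_cong[OF refl])
    fix \<omega> assume "\<omega> \<in> space (C 0 n ?u)"
    note \<omega> = eP_space[OF this]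
    have "fun_upd \<omega> n \<in> P n \<omega> \<rightarrow>\<^sub>M PiM {0..<Suc n} M"
      using \<omega> by (intro measurable_fun_upd[where J = "{0..<n}"]) auto
    then show "(\<integral>\<omega>'. h (\<omega>' n) \<partial>eP n \<omega>) = (\<integral>x. h x \<partial>P n \<omega>)"
      unfolding eP_def using meas by (subst integral_distr) auto
  qed
  finally show ?thesis .
qed

text \<open>The tower property on the infinite trajectory space: pass to finitely many steps,
  integrate out the last draw, and pass back.\<close>

lemma integral_lim_component:
  fixes h :: "'a \<Rightarrow> real"
  assumes h [measurable]: "h \<in> borel_measurable (M n)" and B: "\<And>x. \<bar>h x\<bar> \<le> B"
  shows "(\<integral>\<omega>. h (\<omega> n) \<partial>PF.lim) = (\<integral>\<omega>. (\<integral>x. h x \<partial>P n (restrict \<omega> {0..<n})) \<partial>PF.lim)"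
proof -
  have "(\<integral>\<omega>. h (\<omega> n) \<partial>PF.lim) = (\<integral>\<omega>. h (restrict \<omega> {0..<Suc n} n) \<partial>PF.lim)"
    by simp
  also have "\<dots> = (\<integral>\<omega>. h (\<omega> n) \<partial>C 0 (Suc n) (\<lambda>_. undefined))"
    by (rule integral_lim_eq_integral_C) measurable
  also have "\<dots> = (\<integral>\<omega>. (\<integral>x. h x \<partial>P n \<omega>) \<partial>C 0 n (\<lambda>_. undefined))"
    by (rule integral_C_Suc[OF h B])
  also have "\<dots> = (\<integral>\<omega>. (\<integral>x. h x \<partial>P n (restrict \<omega> {0..<n})) \<partial>PF.lim)"
    by (rule integral_lim_eq_integral_C[symmetric]) measurable
  finally show ?thesis .
qed

end

lemma integral_bind_bmfun:
  fixes h :: "'b::topological_space bmfun"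
  assumes M: "prob_space M" "sets M = sets borel"
    and \<kappa>: "(\<kappa> :: 'a::topological_space \<Rightarrow> 'b measure) \<in> borel \<rightarrow>\<^sub>M prob_algebra borel"
  shows "(\<integral>y. h y \<partial>(M \<bind> \<kappa>)) = (\<integral>x. markov_op \<kappa> h x \<partial>M)"
proof -
  have "(\<integral>y. h y \<partial>(M \<bind> \<kappa>)) = (\<integral>x. (\<integral>y. h y \<partial>\<kappa> x) \<partial>M)"
  proof (rule integral_bind[where K = borel and B = "norm h" and B' = 1])
    show "\<kappa> \<in> M \<rightarrow>\<^sub>M subprob_algebra borel"
      using measurable_prob_algebraD[OF \<kappa>] by (simp add: measurable_cong_sets[OF M(2) refl])
    show "finite_measure M" using M(1) by (rule prob_space.finite_measure)
    show "AE x in M. emeasure (\<kappa> x) (space (\<kappa> x)) \<le> ennreal 1"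
      by (simp add: prob_space.emeasure_space_1[OF kernel_prob_space[OF \<kappa>]])
  qed (auto simp: abs_le_norm_bmfun)
  then show ?thesis by (simp add: \<kappa>)
qed

section \<open>Value functions of softmax policies and the Bellman equation\<close>

locale regularized_mdp = action_space \<mu> for \<mu> :: "'a::polish_space measure" +
  fixes P :: "'s::polish_space \<times> 'a \<Rightarrow> 's measure"
    and c :: "('s \<times> 'a) bmfun" and \<gamma> \<tau> :: real
  assumes P: "P \<in> borel \<rightarrow>\<^sub>M prob_algebra borel"
    and \<gamma>: "0 \<le> \<gamma>" "\<gamma> < 1" and \<tau>: "0 < \<tau>"
begin

definition step_op :: "('s \<times> 'a) bmfun \<Rightarrow> 's bmfun \<Rightarrow> 's bmfun" where
  "step_op f W = policy_op f (markov_op P W)"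

text \<open>Written as a resolvent so that operator theory on the Banach space applies;
  \<open>state_value_softmax\<close> identifies it with the trajectory expectation. By
  \<open>KL_softmax\<close> the term multiplied by \<open>\<tau>\<close> is the relative
  entropy.\<close>

definition soft_value :: "('s \<times> 'a) bmfun \<Rightarrow> 's bmfun" where
  "soft_value f =
    resolvent \<gamma> (step_op f) (policy_op f c + \<tau> *\<^sub>R (policy_op f f - log_partition f))"

text \<open>The function \<open>k\<^sub>f\<close> of the overview: the action value plus
  \<open>\<tau>\<close> f. Including \<open>\<tau>\<close> f leaves only the log-partition function
  outside the policy average in the Bellman equation.\<close>

definition tilted_action_value :: "('s \<times> 'a) bmfun \<Rightarrow> ('s \<times> 'a) bmfun" where
  "tilted_action_value f = c + \<gamma> *\<^sub>R markov_op P (soft_value f) + \<tau> *\<^sub>R f"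

lemma bounded_linear_step_op: "bounded_linear (step_op f)"
  unfolding step_op_def[abs_def]
  by (intro bounded_linear_compose[OF bounded_linear_policy_op bounded_linear_markov_op] P)

lemma norm_step_op_le: "norm (step_op f W) \<le> norm W"
  unfolding step_op_def by (rule order_trans[OF norm_policy_op_le norm_markov_op_le[OF P]])

lemmas step_op_contraction = \<gamma> bounded_linear_step_op norm_step_op_le

lemma step_op_nonneg:
  "(\<And>y. 0 \<le> apply_bmfun W y) \<Longrightarrow> 0 \<le> apply_bmfun (step_op f W) s"
  unfolding step_op_def by (intro policy_op_nonneg markov_op_nonneg P)

lemma trajectory_expectation:
  fixes f h :: "('s \<times> 'a) bmfun" and s :: 's
  defines "M \<equiv> trajectory_measure P (softmax_policy \<mu> f) s"
  shows "prob_space M"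
    and "(\<lambda>\<omega>. h (\<omega> n)) \<in> borel_measurable M"
    and "(\<integral>\<omega>. h (\<omega> n) \<partial>M) = ((step_op f ^^ n) (policy_op f h)) s"
proof -
  let ?\<pi> = "softmax_policy \<mu> f"
  interpret IT: Ionescu_Tulcea "trajectory_kernel P ?\<pi> s" "\<lambda>_. borel"
    by (rule Ionescu_Tulcea_trajectory_kernel[OF P softmax_measurable])
  have M: "M = IT.PF.lim" by (simp add: M_def trajectory_measure_def)
  \<comment> \<open>Projecting onto no coordinates gives a probability measure, and a pushforward
    preserves total mass, so the limit measure has mass 1.\<close>
  have "(\<lambda>\<omega>. restrict \<omega> {}) \<in> IT.PF.lim \<rightarrow>\<^sub>M PiM {} (\<lambda>_. borel)"
    unfolding measurable_cong_sets[OF IT.PF.sets_lim refl] by (rule measurable_restrict_subset) simp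
  then show "prob_space M"
    unfolding M by (rule prob_space_distrD) (simp add: IT.distr_lim IT.PF.prob_space_P)
  show "(\<lambda>\<omega>. h (\<omega> n)) \<in> borel_measurable M" for h :: "('s \<times> 'a) bmfun" and n
    unfolding M measurable_cong_sets[OF IT.PF.sets_lim refl] by measurable
  show "(\<integral>\<omega>. h (\<omega> n) \<partial>M) = ((step_op f ^^ n) (policy_op f h)) s"
  \<comment> \<open>Integrating out the last state and action turns h at time n + 1 into another
    function at time n, so the induction hypothesis must cover all h.\<close>
  proof (induction n arbitrary: h)
    case 0
    interpret M: prob_space M by fact
    show ?case
      unfolding M
      by (subst IT.integral_lim_component[OF _ abs_le_norm_bmfun])
         (simp_all add: trajectory_kernel_def integral_draw_action sets_softmax
            M.prob_space[unfolded M, simplified])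
  next
    case (Suc n)
    have "(\<integral>\<omega>. h (\<omega> (Suc n)) \<partial>M) =
        (\<integral>\<omega>. (\<integral>x. h x \<partial>(P (\<omega> n) \<bind> draw_action ?\<pi>)) \<partial>M)"
      unfolding M
      by (subst IT.integral_lim_component[OF _ abs_le_norm_bmfun])
         (simp_all add: trajectory_kernel_def)
    also have "\<dots> = (\<integral>\<omega>. markov_op P (policy_op f h) (\<omega> n) \<partial>M)"
      by (simp add: integral_bind_bmfun kernel_prob_space[OF P] sets_kernel_borel[OF P] P
          draw_softmax_measurable policy_op_def del: apply_policy_op)
    also have "\<dots> = ((step_op f ^^ n) (step_op f (policy_op f h))) s"
      by (simp only: Suc flip: step_op_def)
    finally show ?case by (simp only: funpow_swap1 funpow.simps o_apply)
  qed
qed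

text \<open>The running cost, entropy included, is one bounded function h of state and action.
  Domination by a geometric series allows exchanging sum and expectation, which produces the Neumann
  series evaluated at s.\<close>

lemma state_value_softmax:
  "state_value P c \<gamma> \<mu> \<tau> (softmax_policy \<mu> f) s = soft_value f s"
proof -
  let ?M = "trajectory_measure P (softmax_policy \<mu> f) s"
  interpret M: prob_space ?M by (rule trajectory_expectation)
  interpret ev: bounded_linear "\<lambda>f::'s bmfun. apply_bmfun f s" by (rule bounded_linear_apply_bmfun)
  define h where "h = c + \<tau> *\<^sub>R state_fun (policy_op f f - log_partition f)"
  interpret L: bounded_linear "policy_op f" by (rule bounded_linear_policy_op)
  have r: "policy_op f c + \<tau> *\<^sub>R (policy_op f f - log_partition f) = policy_op f h"
    by (simp add: h_def L.add L.scaleR)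
  have bound: "\<bar>\<gamma> ^ n * h x\<bar> \<le> \<gamma> ^ n * norm h" for n x
    using \<gamma> by (simp add: abs_mult abs_le_norm_bmfun mult_left_mono)
  have summable: "summable (\<lambda>n. \<gamma> ^ n * norm h)"
    using \<gamma> by (intro summable_mult2 summable_geometric) simp
  have meas [measurable]: "(\<lambda>\<omega>. h (\<omega> n)) \<in> borel_measurable ?M" for n
    by (rule trajectory_expectation)
  have int: "integrable ?M (\<lambda>\<omega>. \<gamma> ^ n * h (\<omega> n))" for n
    by (rule M.integrable_bounded[OF _ bound]) measurable
  have "state_value P c \<gamma> \<mu> \<tau> (softmax_policy \<mu> f) s = (\<integral>\<omega>. (\<Sum>n. \<gamma> ^ n * h (\<omega> n)) \<partial>?M)"
    by (simp add: state_value_def KL_softmax h_def)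
  also have "\<dots> = (\<Sum>n. \<integral>\<omega>. \<gamma> ^ n * h (\<omega> n) \<partial>?M)"
  proof (rule integral_suminf[OF int])
    show "AE \<omega> in ?M. summable (\<lambda>n. norm (\<gamma> ^ n * h (\<omega> n)))"
      using bound by (intro AE_I2 summable_comparison_test'[OF summable, of 0]) simp
    show "summable (\<lambda>n. \<integral>\<omega>. norm (\<gamma> ^ n * h (\<omega> n)) \<partial>?M)"
    proof (rule summable_comparison_test'[OF summable, of 0])
      have "\<bar>\<integral>\<omega>. \<bar>\<gamma> ^ n * h (\<omega> n)\<bar> \<partial>?M\<bar> \<le> \<gamma> ^ n * norm h" for n
        using bound by (intro M.abs_integral_le) auto
      then show "norm (\<integral>\<omega>. norm (\<gamma> ^ n * h (\<omega> n)) \<partial>?M) \<le> \<gamma> ^ n * norm h" for n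
        by simp
    qed
  qed
  also have "\<dots> = (\<Sum>n. \<gamma> ^ n * ((step_op f ^^ n) (policy_op f h)) s)"
    by (simp add: trajectory_expectation del: apply_policy_op)
  also have "\<dots> = soft_value f s"
    unfolding soft_value_def r resolvent_def
    by (subst ev.suminf[OF summable_resolvent[OF step_op_contraction]]) simp
  finally show ?thesis .
qed

lemma action_value_softmax:
  "action_value P c \<gamma> \<mu> \<tau> (softmax_policy \<mu> f) s a =
    (c + \<gamma> *\<^sub>R markov_op P (soft_value f)) (s, a)"
  by (simp add: action_value_def state_value_softmax P)

lemma soft_value_bellman:
  "soft_value f = policy_op f (tilted_action_value f) - \<tau> *\<^sub>R log_partition f"
proof -
  interpret L: bounded_linear "policy_op f" by (rule bounded_linear_policy_op)
  show ?thesis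
    unfolding tilted_action_value_def L.add L.scaleR
    by (subst resolvent_fixed_point[OF step_op_contraction, of f
          "policy_op f c + \<tau> *\<^sub>R (policy_op f f - log_partition f)", folded soft_value_def])
       (simp add: step_op_def scaleR_diff_right)
qed


section \<open>The policy gradient\<close>

definition soft_value_deriv :: "('s \<times> 'a) bmfun \<Rightarrow> ('s \<times> 'a) bmfun \<Rightarrow> 's bmfun" where
  "soft_value_deriv f u = resolvent \<gamma> (step_op f) (policy_cov f (tilted_action_value f) u)"

lemma bounded_linear_soft_value_deriv: "bounded_linear (soft_value_deriv f)"
  unfolding soft_value_deriv_def[abs_def]
  by (rule bounded_linear_compose[OF bounded_linear_resolvent[OF step_op_contraction]
        bounded_linear_policy_cov])

lemma norm_soft_value_deriv_le:
  "norm (soft_value_deriv f u) \<le> 2 * norm (tilted_action_value f) * norm u / (1 - \<gamma>)"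
proof -
  have "norm (soft_value_deriv f u) \<le> norm (policy_cov f (tilted_action_value f) u) / (1 - \<gamma>)"
    unfolding soft_value_deriv_def by (rule norm_resolvent_le[OF step_op_contraction])
  also have "\<dots> \<le> 2 * norm (tilted_action_value f) * norm u / (1 - \<gamma>)"
    using \<gamma> norm_policy_cov_le by (intro divide_right_mono) auto
  finally show ?thesis .
qed

text \<open>Subtract the two Bellman equations and compare both policies on the old
  \<open>tilted_action_value f\<close>. The change of the continuation value becomes the recursive
  term, with the transition operator of the new policy.\<close>

lemma performance_difference:
  "soft_value (f + u) - soft_value f =
    (policy_op (f + u) (tilted_action_value f) - policy_op f (tilted_action_value f)
      + \<tau> *\<^sub>R (policy_op (f + u) u - (log_partition (f + u) - log_partition f)))
    + \<gamma> *\<^sub>R step_op (f + u) (soft_value (f + u) - soft_value f)"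
proof -
  interpret L: bounded_linear "policy_op (f + u)" by (rule bounded_linear_policy_op)
  interpret P: bounded_linear "markov_op P" by (rule bounded_linear_markov_op[OF P])
  have "tilted_action_value (f + u) = tilted_action_value f + \<tau> *\<^sub>R u
      + \<gamma> *\<^sub>R markov_op P (soft_value (f + u) - soft_value f)"
    by (simp add: tilted_action_value_def P.diff algebra_simps)
  then have exp: "policy_op (f + u) (tilted_action_value (f + u)) = policy_op (f + u) (tilted_action_value f)
      + \<tau> *\<^sub>R policy_op (f + u) u + \<gamma> *\<^sub>R step_op (f + u) (soft_value (f + u) - soft_value f)"
    by (simp add: L.add L.scaleR step_op_def)
  note arg_cong2[OF soft_value_bellman[of "f + u"] soft_value_bellman[of f], of "(-)"]
  then show ?thesis
    unfolding exp by (rule trans) (simp add: algebra_simps)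
qed

text \<open>The value increment and the candidate derivative \<open>D\<close> solve fixed-point
  equations with different transition operators. Rewriting the equation for \<open>D\<close> with
  the new operator costs \<open>E3\<close>. The remainder then solves a fixed-point equation with
  source \<open>E1\<close> + \<open>\<tau>\<close> \<open>E2\<close> + \<open>\<gamma>\<close>
  \<open>E3\<close>, and the a priori bound applies.\<close>

lemma soft_value_remainder:
  assumes u: "norm u \<le> 1"
  shows "norm (soft_value (f + u) - soft_value f - soft_value_deriv f u)
    \<le> (18 * norm (tilted_action_value f) + 21 * \<tau> + 40 * norm (tilted_action_value f) / (1 - \<gamma>))
        / (1 - \<gamma>) * (norm u)\<^sup>2"
proof -
  define k D \<delta> where "k = tilted_action_value f" and "D = soft_value_deriv f u" and "\<delta> = norm u"
  have \<delta>: "0 \<le> \<delta>" "\<delta> \<le> 1" using u by (auto simp: \<delta>_def)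
  then have \<delta>2: "\<delta>\<^sup>2 \<le> \<delta>" by (simp add: power2_eq_square mult_left_le)
  interpret L: bounded_linear "step_op (f + u)" by (rule bounded_linear_step_op)
  define E1 where "E1 = policy_op (f + u) k - policy_op f k - policy_cov f k u"
  define E2 where "E2 = policy_op (f + u) u - (log_partition (f + u) - log_partition f)"
  define E3 where "E3 = step_op (f + u) D - step_op f D"
  have D: "D = policy_cov f k u + \<gamma> *\<^sub>R step_op f D"
    unfolding D_def soft_value_deriv_def k_def
    by (rule resolvent_fixed_point[OF step_op_contraction])
  have "soft_value (f + u) - soft_value f - D = (E1 + \<tau> *\<^sub>R E2 + \<gamma> *\<^sub>R E3)
      + \<gamma> *\<^sub>R step_op (f + u) (soft_value (f + u) - soft_value f - D)"
    using arg_cong2[OF performance_difference[of f u] D, of "(-)"]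
    unfolding L.diff[of _ D] E1_def E2_def E3_def k_def
    by (simp only: scaleR_diff_right) (simp add: algebra_simps)
  from fixed_point_norm_le[OF \<gamma> norm_step_op_le this]
  have "norm (soft_value (f + u) - soft_value f - D) \<le> norm (E1 + \<tau> *\<^sub>R E2 + \<gamma> *\<^sub>R E3) / (1 - \<gamma>)" .
  also have "norm (E1 + \<tau> *\<^sub>R E2 + \<gamma> *\<^sub>R E3) \<le> norm E1 + \<tau> * norm E2 + 1 * norm E3"
  proof -
    have "norm (E1 + \<tau> *\<^sub>R E2 + \<gamma> *\<^sub>R E3) \<le> norm E1 + norm (\<tau> *\<^sub>R E2) + norm (\<gamma> *\<^sub>R E3)"
      by (intro order_trans[OF norm_triangle_ineq] add_mono norm_triangle_ineq) auto
    also have "norm (\<gamma> *\<^sub>R E3) \<le> 1 * norm E3"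
      using \<gamma> by (simp add: mult_left_le_one_le)
    finally show ?thesis using \<tau> by simp
  qed
  \<comment> \<open>\<open>E1\<close> is a second-order remainder. In \<open>E2\<close> the mean
    \<open>policy_op f u\<close> cancels between the two expansions, which leaves 18 + 2 + 1 = 21
    because \<open>\<delta>\<close> <= 1. \<open>E3\<close> is of first order in u and linear in
    \<open>D\<close>, itself of first order, with constant 20 * 2 = 40.\<close>
  also have "\<dots> \<le> 18 * norm k * \<delta>\<^sup>2 + \<tau> * (21 * \<delta>\<^sup>2) + 1 * (40 * norm k / (1 - \<gamma>) * \<delta>\<^sup>2)"
  proof (intro add_mono mult_left_mono)
    show "norm E1 \<le> 18 * norm k * \<delta>\<^sup>2"
      unfolding E1_def \<delta>_def by (rule policy_op_expansion[OF u])
    have "E2 = (policy_op (f + u) u - policy_op f u - policy_cov f u u) + policy_cov f u u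
        - (log_partition (f + u) - log_partition f - policy_op f u)"
      by (simp add: E2_def)
    also have "norm \<dots> \<le> 18 * \<delta> * \<delta>\<^sup>2 + 2 * \<delta> * \<delta> + \<delta>\<^sup>2"
      unfolding \<delta>_def
      by (intro order_trans[OF norm_triangle_ineq4] order_trans[OF norm_triangle_ineq] add_mono
          policy_op_expansion log_partition_expansion norm_policy_cov_le u)
    also have "\<dots> \<le> 21 * \<delta>\<^sup>2"
      using mult_right_mono[OF \<delta>(2), of "\<delta>\<^sup>2"] by (simp add: power2_eq_square)
    finally show "norm E2 \<le> 21 * \<delta>\<^sup>2" .
    define h where "h = markov_op P D"
    have "E3 = (policy_op (f + u) h - policy_op f h - policy_cov f h u) + policy_cov f h u"
      by (simp add: E3_def step_op_def h_def)
    also have "norm \<dots> \<le> 18 * norm h * \<delta>\<^sup>2 + 2 * norm h * \<delta>"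
      unfolding \<delta>_def
      by (intro order_trans[OF norm_triangle_ineq] add_mono policy_op_expansion norm_policy_cov_le u)
    also have "\<dots> \<le> 20 * \<delta> * norm h"
      using mult_left_mono[OF \<delta>2, of "norm h"] by (simp add: algebra_simps)
    also have "\<dots> \<le> 20 * \<delta> * (2 * norm k * \<delta> / (1 - \<gamma>))"
      unfolding h_def D_def k_def \<delta>_def
      by (intro mult_left_mono order_trans[OF norm_markov_op_le[OF P]] norm_soft_value_deriv_le) simp
    finally show "norm E3 \<le> 40 * norm k / (1 - \<gamma>) * \<delta>\<^sup>2"
      by (simp add: power2_eq_square ac_simps)
  qed (use \<tau> in auto)
  finally show ?thesis
    using \<gamma> by (simp add: k_def D_def \<delta>_def algebra_simps add_divide_distrib divide_right_mono)
qed

lemma has_derivative_soft_value: "(soft_value has_derivative soft_value_deriv f) (at f)"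
  by (rule has_derivative_quadratic_remainder[OF bounded_linear_soft_value_deriv soft_value_remainder])

text \<open>Applied with W the value and u the time derivative of the potential. The covariance in
  the derivative becomes minus a variance, and the resolvent preserves signs.\<close>

lemma soft_value_deriv_flow_nonpos:
  assumes "tilted_action_value f = state_fun W - u"
  shows "apply_bmfun (soft_value_deriv f u) s \<le> 0"
proof -
  interpret R: bounded_linear "resolvent \<gamma> (step_op f)"
    by (rule bounded_linear_resolvent[OF step_op_contraction])
  have "0 \<le> apply_bmfun (resolvent \<gamma> (step_op f) (policy_cov f u u)) s"
    by (rule resolvent_nonneg[OF step_op_contraction step_op_nonneg policy_cov_self_nonneg])
  then show ?thesis
    by (simp add: soft_value_deriv_def assms policy_cov_state_fun_diff R.neg)
qed

end

section \<open>Monotonicity of the value along the flow, by the chain rule in the sup norm\<close>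

theorem proposition2p6:
  fixes P :: "'s::polish_space \<times> 'a::polish_space \<Rightarrow> 's measure"
    and c :: "('s \<times> 'a) bmfun"
    and \<gamma> \<tau> T :: real
    and \<mu> :: "'a measure"
    and Z\<^sub>0 :: "('s \<times> 'a) bmfun"
    and Z Z' :: "real \<Rightarrow> ('s \<times> 'a) bmfun"
    and \<pi> :: "real \<Rightarrow> 's \<Rightarrow> 'a measure"
  assumes "P \<in> borel \<rightarrow>\<^sub>M prob_algebra borel"
    and "0 \<le> \<gamma>" and "\<gamma> < 1"
    and "prob_space \<mu>" and "sets \<mu> = sets borel"
    and "0 < \<tau>" and "0 < T"
    and "\<And>t. t \<in> {0..<T} \<Longrightarrow> (Z has_vector_derivative Z' t) (at t within {0..<T})"
    and "continuous_on {0..<T} Z'"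
    and "Z 0 = Z\<^sub>0"
    and "\<And>t. t \<in> {0..<T} \<Longrightarrow> \<pi> t = softmax_policy \<mu> (Z t)"
    and "\<And>t s a. t \<in> {0<..<T} \<Longrightarrow>
      Z' t (s, a) =
        - (action_value P c \<gamma> \<mu> \<tau> (\<pi> t) s a + \<tau> * Z t (s, a) - state_value P c \<gamma> \<mu> \<tau> (\<pi> t) s)"
  shows "\<exists>(V :: real \<Rightarrow> 's bmfun) (V' :: real \<Rightarrow> 's bmfun).
    (\<forall>t\<in>{0..<T}. \<forall>s. apply_bmfun (V t) s = state_value P c \<gamma> \<mu> \<tau> (\<pi> t) s) \<and>
    (\<forall>t\<in>{0..<T}. (V has_vector_derivative V' t) (at t within {0..<T})) \<and>
    (\<forall>t\<in>{0..<T}. \<forall>s. apply_bmfun (V' t) s \<le> 0)"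
proof -
  interpret prob_space \<mu> by fact
  interpret regularized_mdp \<mu> P c \<gamma> \<tau>
    by unfold_locales (use assms in auto)
  note Z = assms(8) and \<pi> = assms(11) and flow = assms(12)
  define V where "V = soft_value \<circ> Z"
  define V' where "V' t = soft_value_deriv (Z t) (Z' t)" for t
  have V_deriv: "(V has_vector_derivative V' t) (at t within {0..<T})" if "t \<in> {0..<T}" for t
    unfolding V_def V'_def
    by (rule vector_derivative_diff_chain_within[OF Z[OF that]])
       (rule has_derivative_at_withinI[OF has_derivative_soft_value])
  have cont: "continuous_on {0..<T} Z" "continuous_on {0..<T} V"
    using continuous_on_vector_derivative[OF Z] continuous_on_vector_derivative[OF V_deriv] by auto
  have evolution: "tilted_action_value (Z t) = state_fun (V t) - Z' t" if t: "t \<in> {0..<T}" for t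
  proof (rule bmfun_eqI)
    fix x
    \<comment> \<open>The defect of the flow equation at the fixed point x, as a continuous function
      of time.\<close>
    define G where "G t = apply_bmfun c x + \<gamma> * markov_op P (V t) x + \<tau> * Z t x + Z' t x - V t (fst x)" for t
    have contP: "continuous_on {0..<T} (\<lambda>t. markov_op P (V t))"
      using bounded_linear.continuous_on[OF bounded_linear_markov_op[OF P] cont(2)] .
    have contG: "continuous_on {0..<T} G"
      unfolding G_def
      by (intro continuous_intros bounded_linear.continuous_on[OF bounded_linear_apply_bmfun]
          contP cont assms(9))
    have G0: "G t = 0" if "t \<in> {0<..<T}" for t
      using that flow[of t "fst x" "snd x"]
      by (simp add: G_def V_def \<pi> action_value_softmax state_value_softmax P)
    have "G t = 0"
    proof (cases "t = 0")
      case True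
      \<comment> \<open>The flow equation is assumed only for t > 0. The defect vanishes on (0,
        T/2), whose closure contains 0 and stays inside [0, T), so continuity extends the equation
        to t = 0.\<close>
      have "{0..T / 2} \<subseteq> {0..<T}" using \<open>0 < T\<close> by auto
      then have "continuous_on (closure {0<..<T / 2}) G"
        using \<open>0 < T\<close> by (simp add: continuous_on_subset[OF contG])
      then show ?thesis
        by (rule continuous_constant_on_closure) (use G0 True \<open>0 < T\<close> in auto)
    qed (use t G0 in auto)
    then show "apply_bmfun (tilted_action_value (Z t)) x = apply_bmfun (state_fun (V t) - Z' t) x"
      by (simp add: G_def tilted_action_value_def V_def)
  qed
  show ?thesis
  proof (rule exI[of _ V], rule exI[of _ V'], intro conjI ballI allI)
    show "apply_bmfun (V t) s = state_value P c \<gamma> \<mu> \<tau> (\<pi> t) s" if "t \<in> {0..<T}" for t s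
      by (simp add: V_def \<pi>[OF that] state_value_softmax)
    show "(V has_vector_derivative V' t) (at t within {0..<T})" if "t \<in> {0..<T}" for t
      by (rule V_deriv[OF that])
    show "apply_bmfun (V' t) s \<le> 0" if "t \<in> {0..<T}" for t s
      unfolding V'_def by (rule soft_value_deriv_flow_nonpos[OF evolution[OF that]])
  qed
qed

end
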